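(* Let $k \geq 2$ be an integer and let $G$ be a connected graph on $n$ vertices such that $d(x) + d(y) \geq n - k + 1$ for every induced subgraph $H$ of $G$ isomorphic to one of $K_{1,2} \cup K_1$, $K_3 \cup K_1$, $K_{1,3}$, $K_{1,3} + e$, $P_4$, and for every pair of distinct nonadjacent vertices $x, y$ of $H$. Then $G$ has a spanning $k$-ended tree.
   Context: All graphs are finite and undirected, with no loops or multiple edges. For a vertex $v$ of $G$, $d(v)$ denotes the degree of $v$ in $G$ (not in the induced subgraph). $K_m$ is the complete graph on $m$ vertices, $K_{m,n}$ is the complete bipartite graph with parts of sizes $m$ and $n$, $P_m$ is the simple path on $m$ vertices, $\cup$ denotes disjoint union of graphs, and $W + e$ denotes a graph obtained from $W$ by adding an edge $e$ joining two nonadjacent vertices of $W$. In particular $K_{1,3}+e$ is the graph (unique up to isomorphism) obtained from $K_{1,3}$ by adding an edge between two of its leaves. A leaf of a tree is a vertex of degree one in the tree. For an integer $k \geq 2$, a $k$-ended tree is a tree with at most $k$ leaves; a spanning $k$-ended tree of $G$ is a spanning tree of $G$ that is a $k$-ended tree. *)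

theory Defs
  imports "Graph_Theory.Graph_Theory"
begin

text \<open>
  A finite simple undirected graph is a \<open>pair_graph\<close>: a finite vertex set together with a
  symmetric irreflexive arc relation. An edge \<open>uv\<close> is the pair of arcs \<open>(u,v)\<close>, \<open>(v,u)\<close>, so
  the degree of a vertex is its out-degree.
\<close>

abbreviation vdegree :: "'a pair_pre_digraph \<Rightarrow> 'a \<Rightarrow> nat" where
  "vdegree G v \<equiv> out_degree (with_proj G) v"

abbreviation connected_graph :: "'a pair_pre_digraph \<Rightarrow> bool" where
  "connected_graph G \<equiv> Digraph_Component.connected (with_proj G)"

abbreviation induced_in :: "'a pair_pre_digraph \<Rightarrow> 'a pair_pre_digraph \<Rightarrow> bool" where
  "induced_in H G \<equiv> induced_subgraph (with_proj H) (with_proj G)"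

abbreviation graph_iso :: "'a pair_pre_digraph \<Rightarrow> 'b pair_pre_digraph \<Rightarrow> bool" where
  "graph_iso G H \<equiv> digraph_iso (with_proj G) (with_proj H)"

definition complete_graph :: "nat \<Rightarrow> nat pair_pre_digraph" where
  "complete_graph m = \<lparr>pverts = {..<m}, parcs = {(i, j). i < m \<and> j < m \<and> i \<noteq> j}\<rparr>"

definition complete_bipartite_graph :: "nat \<Rightarrow> nat \<Rightarrow> (nat + nat) pair_pre_digraph" where
  "complete_bipartite_graph m n =
    \<lparr>pverts = {..<m} <+> {..<n},
     parcs = Inl ` {..<m} \<times> Inr ` {..<n} \<union> Inr ` {..<n} \<times> Inl ` {..<m}\<rparr>"

definition path_graph :: "nat \<Rightarrow> nat pair_pre_digraph" where
  "path_graph m = \<lparr>pverts = {..<m}, parcs = {(i, j). i < m \<and> j < m \<and> (j = Suc i \<or> i = Suc j)}\<rparr>"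

definition disjoint_union ::
    "'a pair_pre_digraph \<Rightarrow> 'b pair_pre_digraph \<Rightarrow> ('a + 'b) pair_pre_digraph" where
  "disjoint_union G H =
    \<lparr>pverts = pverts G <+> pverts H,
     parcs = map_prod Inl Inl ` parcs G \<union> map_prod Inr Inr ` parcs H\<rparr>"

definition add_edge :: "'a pair_pre_digraph \<Rightarrow> 'a \<Rightarrow> 'a \<Rightarrow> 'a pair_pre_digraph" where
  "add_edge W u v = \<lparr>pverts = pverts W, parcs = parcs W \<union> {(u, v), (v, u)}\<rparr>"

text \<open>\<open>Inr 0\<close> and \<open>Inr 1\<close> are two leaves of the star.\<close>

definition claw_plus_edge :: "(nat + nat) pair_pre_digraph" where
  "claw_plus_edge = add_edge (complete_bipartite_graph 1 3) (Inr 0) (Inr 1)"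

text \<open>
  In a symmetric digraph, \<open>pre_digraph.cycle\<close> also holds of the closed walk \<open>u, v, u\<close> along a
  single edge, so that \<open>Digraph_Component.tree\<close> fails for every symmetric digraph with an edge.
  The cycles of an undirected graph are those of length at least three.
\<close>

definition is_tree :: "'a pair_pre_digraph \<Rightarrow> bool" where
  "is_tree T \<longleftrightarrow> pair_graph T \<and> connected_graph T \<and>
     \<not> (\<exists>p. pre_digraph.cycle (with_proj T) p \<and> 3 \<le> length p)"

definition leaves :: "'a pair_pre_digraph \<Rightarrow> 'a set" where
  "leaves T = {v \<in> pverts T. vdegree T v = 1}"

definition ended_tree :: "nat \<Rightarrow> 'a pair_pre_digraph \<Rightarrow> bool" where
  "ended_tree k T \<longleftrightarrow> is_tree T \<and> card (leaves T) \<le> k"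

definition spanning_ended_tree :: "nat \<Rightarrow> 'a pair_pre_digraph \<Rightarrow> 'a pair_pre_digraph \<Rightarrow> bool" where
  "spanning_ended_tree k T G \<longleftrightarrow> ended_tree k T \<and> spanning (with_proj T) (with_proj G)"


subsection \<open>Basic facts\<close>

lemma vdegree_conv: "vdegree G v = card {u. (v, u) \<in> parcs G}"
proof -
  have "out_arcs (with_proj G) v = Pair v ` {u. (v, u) \<in> parcs G}"
    by (auto simp: out_arcs_def)
  then show ?thesis
    by (simp add: out_degree_def card_image inj_on_def)
qed

lemma complete_graph: "complete_digraph m (with_proj (complete_graph m))"
  by (auto simp: complete_digraph_pair_def complete_graph_def)

lemma complete_bipartite_graph:
  "complete_bipartite_digraph m n (with_proj (complete_bipartite_graph m n))"
  unfolding complete_bipartite_digraph_pair_def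
proof (intro conjI exI)
  show "pverts (complete_bipartite_graph m n) = Inl ` {..<m} \<union> Inr ` {..<n}"
    by (auto simp: complete_bipartite_graph_def)
qed (auto simp: complete_bipartite_graph_def card_image)

lemma induced_in_conv:
  assumes "pair_wf_digraph G"
  shows "induced_in H G \<longleftrightarrow>
    pverts H \<subseteq> pverts G \<and> parcs H = {(u, v) \<in> parcs G. u \<in> pverts H \<and> v \<in> pverts H}"
proof -
  interpret pair_wf_digraph G by fact
  have wf_G: "wf_digraph (with_proj G)" by unfold_locales
  have compat: "compatible (with_proj G) (with_proj H)" by (simp add: compatible_def)
  show ?thesis
  proof
    assume "induced_in H G"
    then show "pverts H \<subseteq> pverts G \<and> parcs H = {(u, v) \<in> parcs G. u \<in> pverts H \<and> v \<in> pverts H}"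
      by (auto simp: induced_subgraph_def subgraph_def)
  next
    assume *: "pverts H \<subseteq> pverts G \<and> parcs H = {(u, v) \<in> parcs G. u \<in> pverts H \<and> v \<in> pverts H}"
    then have "wf_digraph (with_proj H)" by (auto simp: wf_digraph_def)
    with * wf_G compat show "induced_in H G"
      by (auto simp: induced_subgraph_def subgraph_def)
  qed
qed

lemma graph_iso_conv:
  assumes "pair_wf_digraph G" "pair_wf_digraph H"
  shows "graph_iso G H \<longleftrightarrow> (\<exists>f. bij_betw f (pverts G) (pverts H) \<and>
    (\<forall>u\<in>pverts G. \<forall>v\<in>pverts G. (u, v) \<in> parcs G \<longleftrightarrow> (f u, f v) \<in> parcs H))"
    (is "?L \<longleftrightarrow> ?R")
proof
  interpret G: pair_wf_digraph G by fact
  assume ?L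
  then obtain h where h: "pre_digraph.digraph_isomorphism (with_proj G) h"
    and H: "with_proj H = app_iso h (with_proj G)"
    by (auto simp: digraph_iso_def)
  let ?f = "iso_verts h"
  have V: "pverts H = ?f ` pverts G" and A: "parcs H = iso_arcs h ` parcs G"
    and th: "iso_tail h = fst" "iso_head h = snd"
    using H by (auto simp: app_iso_def with_proj_def)
  have inj: "inj_on ?f (pverts G)"
    and ends: "\<And>e. e \<in> parcs G \<Longrightarrow> iso_arcs h e = (?f (fst e), ?f (snd e))"
    using h by (auto simp: G.digraph_isomorphism_def th prod_eq_iff)
  have P: "parcs H = (\<lambda>e. (?f (fst e), ?f (snd e))) ` parcs G"
    unfolding A using ends by (intro image_cong) auto
  have "(u, v) \<in> parcs G \<longleftrightarrow> (?f u, ?f v) \<in> parcs H"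
    if "u \<in> pverts G" "v \<in> pverts G" for u v
  proof
    assume "(u, v) \<in> parcs G"
    then show "(?f u, ?f v) \<in> parcs H" unfolding P by (rule rev_image_eqI) simp
  next
    assume "(?f u, ?f v) \<in> parcs H"
    then obtain a b where ab: "(a, b) \<in> parcs G" "?f u = ?f a" "?f v = ?f b"
      unfolding P by auto
    then have "u = a" "v = b"
      using that inj G.in_arcsD1 G.in_arcsD2 by (auto dest: inj_onD)
    with ab show "(u, v) \<in> parcs G" by simp
  qed
  with V inj show ?R by (auto simp: bij_betw_def)
next
  interpret G: pair_wf_digraph G by fact
  interpret H: pair_wf_digraph H by fact
  assume ?R
  then obtain f where f: "inj_on f (pverts G)" "f ` pverts G = pverts H"
    and adj: "\<And>u v. u \<in> pverts G \<Longrightarrow> v \<in> pverts G \<Longrightarrow> (u, v) \<in> parcs G \<longleftrightarrow> (f u, f v) \<in> parcs H"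
    by (auto simp: bij_betw_def)
  let ?h = "\<lparr>iso_verts = f, iso_arcs = map_prod f f, iso_head = snd, iso_tail = fst\<rparr>"
  have "inj_on (map_prod f f) (parcs G)"
  proof (rule inj_onI, clarify)
    fix a b c d assume "(a, b) \<in> parcs G" "(c, d) \<in> parcs G" "map_prod f f (a, b) = map_prod f f (c, d)"
    then show "a = c \<and> b = d"
      using f(1) by (auto dest: inj_onD G.in_arcsD1 G.in_arcsD2)
  qed
  then have 1: "G.digraph_isomorphism ?h"
    using f(1) by (auto simp: G.digraph_isomorphism_def G.wf_digraph)
  have "parcs H \<subseteq> map_prod f f ` parcs G"
  proof
    fix e assume e: "e \<in> parcs H"
    obtain a b where ab: "e = (a, b)" by (cases e)
    with e f(2) obtain u v where "u \<in> pverts G" "v \<in> pverts G" "a = f u" "b = f v"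
      using H.in_arcsD1 H.in_arcsD2 by (metis imageE)
    with e ab adj show "e \<in> map_prod f f ` parcs G" by (intro image_eqI[of _ _ "(u, v)"]) auto
  qed
  moreover have "map_prod f f ` parcs G \<subseteq> parcs H"
  proof (rule image_subsetI)
    fix e assume "e \<in> parcs G"
    then show "map_prod f f e \<in> parcs H"
      using adj[of "fst e" "snd e"] G.in_arcsD1[of "fst e" "snd e"] G.in_arcsD2[of "fst e" "snd e"]
      by (cases e) simp
  qed
  ultimately have "parcs H = map_prod f f ` parcs G" by blast
  with f(2) have "with_proj H = app_iso ?h (with_proj G)"
    by (simp add: app_iso_def with_proj_def)
  with 1 show ?L by (auto simp: digraph_iso_def)
qed

end

theory Submission
  imports Defs
begin

text \<open>
  The restriction to five induced subgraphs is only apparent. Suppose that \<open>x\<close> and \<open>y\<close> are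
  nonadjacent and lie together in none of them, and sort the other vertices by their adjacency to
  \<open>x\<close> and \<open>y\<close>. If some vertex \<open>u\<close> is a common neighbour, then every further vertex \<open>v\<close> is one
  as well, since otherwise \<open>x, y, u, v\<close> induce one of the five graphs
  (\<open>common_neighbour_dominates\<close>); then both degrees are \<open>n - 2\<close>, which is more than enough.
  If there is no common neighbour, then a neighbour \<open>u\<close> of \<open>x\<close> forms with \<open>x\<close> a component
  missing \<open>y\<close> (\<open>private_neighbour_isolates\<close>), which contradicts connectedness. Hence
  \<open>d(x) + d(y) \<ge> n - k + 1\<close> holds for all pairs of distinct nonadjacent vertices.

  What remains is the theorem of Broersma and Tuinstra (\<open>ore_spanning_ended_tree\<close>). Take a
  longest path, on \<open>m\<close> vertices. If \<open>m < n\<close>, its vertices do not span a cycle, because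
  connectedness would turn such a cycle into a longer path. So the ends of the path are
  nonadjacent, and Ore's crossing argument gives them degree sum at most \<open>m - 1\<close>
  (\<open>longest_path_ends\<close>). Together with the degree condition, at most \<open>k - 2\<close> vertices lie off the
  path. The path is a tree with at most two leaves, and each remaining vertex can be attached to
  the tree as a pendant vertex, at the price of at most one more leaf
  (\<open>extend_to_spanning_tree\<close>).
\<close>

section \<open>Connectedness\<close>

text \<open>
  The library's connectedness refers to the symmetric closure of the arcs and to walks confined to
  the vertex set. Both are automatic in an undirected graph, which leaves plain reachability.
\<close>

lemma (in pair_graph) connected_graph_iff:
  "connected_graph G \<longleftrightarrow> pverts G \<noteq> {} \<and> (\<forall>u\<in>pverts G. \<forall>v\<in>pverts G. (u, v) \<in> (parcs G)\<^sup>*)"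
proof -
  have "sym (parcs G)" using arcs_symmetric by (auto simp: sym_def)
  then have "(parcs G)\<^sup>s = parcs G" by (auto simp: symcl_def sym_def)
  moreover have "(u, v) \<in> rtrancl_on (pverts G) (parcs G) \<longleftrightarrow> (u, v) \<in> (parcs G)\<^sup>*"
    if "u \<in> pverts G" for u v
  proof
    assume "(u, v) \<in> (parcs G)\<^sup>*"
    then show "(u, v) \<in> rtrancl_on (pverts G) (parcs G)"
      using that by induction (auto intro: rtrancl_on_into_rtrancl_on dest: in_arcsD1 in_arcsD2)
  qed (rule rtrancl_on_rtranclI)
  ultimately show ?thesis by (simp add: connected_conv)
qed

lemma (in pair_graph) crossing_arc:
  assumes "connected_graph G" "S \<subseteq> pverts G" "S \<noteq> {}" "S \<noteq> pverts G"
  obtains u w where "u \<in> S" "w \<in> pverts G - S" "(u, w) \<in> parcs G"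
proof -
  obtain a b where ab: "a \<in> S" "b \<in> pverts G - S" using assms by auto
  then have "(a, b) \<in> (parcs G)\<^sup>*" using assms connected_graph_iff by blast
  then have "b \<in> S \<or> (\<exists>u w. u \<in> S \<and> w \<notin> S \<and> (u, w) \<in> parcs G)"
    using ab(1) by induction auto
  with ab that in_arcsD2 show thesis by blast
qed

section \<open>Attaching leaves to a tree\<close>

definition attach_leaf :: "'a pair_pre_digraph \<Rightarrow> 'a \<Rightarrow> 'a \<Rightarrow> 'a pair_pre_digraph" where
  "attach_leaf T u w = \<lparr>pverts = insert w (pverts T), parcs = parcs T \<union> {(u, w), (w, u)}\<rparr>"

lemma attach_leaf_simps [simp]:
  "pverts (attach_leaf T u w) = insert w (pverts T)"
  "parcs (attach_leaf T u w) = parcs T \<union> {(u, w), (w, u)}"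
  by (auto simp: attach_leaf_def)

lemma pair_graphI:
  assumes "finite (pverts T)" "parcs T \<subseteq> pverts T \<times> pverts T" "sym (parcs T)" "irrefl (parcs T)"
  shows "pair_graph T"
proof
  show "finite (parcs T)" using assms(1,2) by (meson finite_SigmaI finite_subset)
qed (use assms in \<open>auto simp: symmetric_def irrefl_def\<close>)

lemma pair_graph_attach_leaf:
  assumes "pair_graph T" "u \<in> pverts T" "w \<notin> pverts T"
  shows "pair_graph (attach_leaf T u w)"
proof -
  interpret pair_graph T by fact
  show ?thesis
    by (rule pair_graphI)
      (use assms pair_finite_verts in
        \<open>auto simp: sym_def irrefl_def dest: in_arcsD1 in_arcsD2 arcs_symmetric no_loops'\<close>)
qed

lemma connected_attach_leaf:
  assumes "pair_graph T" "connected_graph T" "u \<in> pverts T" "w \<notin> pverts T"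
  shows "connected_graph (attach_leaf T u w)"
proof -
  interpret T: pair_graph T by fact
  interpret A: pair_graph "attach_leaf T u w" using assms by (intro pair_graph_attach_leaf)
  let ?R = "parcs (attach_leaf T u w)"
  have sub: "(parcs T)\<^sup>* \<subseteq> ?R\<^sup>*" by (rule rtrancl_mono) auto
  have to: "(a, u) \<in> ?R\<^sup>* \<and> (u, a) \<in> ?R\<^sup>*" if "a \<in> insert w (pverts T)" for a
  proof (cases "a = w")
    case False
    with that assms(2,3) sub show ?thesis by (auto simp: T.connected_graph_iff)
  qed auto
  then have "(a, b) \<in> ?R\<^sup>*" if "a \<in> insert w (pverts T)" "b \<in> insert w (pverts T)" for a b
    using that by (meson rtrancl_trans)
  then show ?thesis by (simp add: A.connected_graph_iff)
qed

text \<open>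
  On a closed walk, the successor and predecessor of an arc are taken modulo the length. This avoids
  rotating the walk when an arc of interest sits at its seam.
\<close>

lemma pcas_last: "pcas u p v \<Longrightarrow> p \<noteq> [] \<Longrightarrow> snd (last p) = v"
  by (induction p arbitrary: u) auto

lemma pcas_nth_Suc: "pcas u p v \<Longrightarrow> Suc i < length p \<Longrightarrow> fst (p ! Suc i) = snd (p ! i)"
proof (induction p arbitrary: u i)
  case (Cons e p)
  then show ?case by (cases i; cases p) auto
qed simp

lemma closed_walk_successor:
  assumes "pcas u p u" "i < length p"
  shows "fst (p ! (Suc i mod length p)) = snd (p ! i)"
proof (cases "Suc i = length p")
  case True
  with assms have "p \<noteq> []" "fst (p ! 0) = u" by (cases p; auto)+
  moreover have "p ! i = last p" using True \<open>p \<noteq> []\<close> by (simp add: last_conv_nth flip: True)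
  ultimately show ?thesis using True pcas_last[OF assms(1)] by simp
next
  case False
  with assms show ?thesis using pcas_nth_Suc[OF assms(1), of i] by simp
qed

lemma closed_walk_predecessor:
  assumes "pcas u p u" "i < length p"
  obtains j where "j < length p" "snd (p ! j) = fst (p ! i)" "i = Suc j mod length p"
proof -
  define j where "j = (if i = 0 then length p - 1 else i - 1)"
  have "j < length p" "i = Suc j mod length p" using assms(2) by (auto simp: j_def)
  with closed_walk_successor[OF assms(1), of j] that show thesis by simp
qed

lemma cycle_iff:
  "pre_digraph.cycle (with_proj T) p \<longleftrightarrow>
    p \<noteq> [] \<and> set p \<subseteq> parcs T \<and> distinct (map snd p) \<and> (\<exists>u\<in>pverts T. pcas u p u)"
proof -
  have "tl (pawalk_verts u p) = map snd p" if "pcas u p u" for u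
    using that pre_digraph.awalk_verts_conv'[of "with_proj T" u p u]
    by (simp add: cas_with_proj_eq awalk_verts_with_proj_eq split: if_splits)
  then show ?thesis
    by (auto simp: pre_digraph.cycle_def pre_digraph.awalk_def cas_with_proj_eq
        awalk_verts_with_proj_eq)
qed

text \<open>
  A cycle through the pendant vertex \<open>w\<close> would have to pass \<open>u, w, u\<close> and so be the closed walk of
  length two, which does not count as a cycle; any other cycle already lies in \<open>T\<close>.
\<close>

lemma is_tree_attach_leaf:
  assumes "is_tree T" "u \<in> pverts T" "w \<notin> pverts T"
  shows "is_tree (attach_leaf T u w)"
proof -
  have T: "pair_graph T" "connected_graph T" using assms by (auto simp: is_tree_def)
  interpret T: pair_graph T by fact
  have "\<not> 3 \<le> length p" if cyc: "pre_digraph.cycle (with_proj (attach_leaf T u w)) p" for p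
  proof
    assume len: "3 \<le> length p"
    obtain x where p: "set p \<subseteq> parcs T \<union> {(u, w), (w, u)}" "distinct (map snd p)" "pcas x p x"
      using cyc by (auto simp: cycle_iff)
    have "u \<noteq> w" using assms by auto
    have w_arc: "e = (w, u)" if "e \<in> set p" "fst e = w" for e
      using subsetD[OF p(1) that(1)] that(2) \<open>u \<noteq> w\<close> assms(3) T.in_arcsD1 by (cases e) auto
    have w_arc': "e = (u, w)" if "e \<in> set p" "snd e = w" for e
      using subsetD[OF p(1) that(1)] that(2) \<open>u \<noteq> w\<close> assms(3) T.in_arcsD2 by (cases e) auto
    have "\<not> set p \<subseteq> parcs T"
    proof
      assume *: "set p \<subseteq> parcs T"
      moreover have "x \<in> pverts T"
        using len p(3) * T.in_arcsD1 by (cases p) auto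
      ultimately have "pre_digraph.cycle (with_proj T) p"
        using p len by (auto simp: cycle_iff)
      with assms(1) len show False by (auto simp: is_tree_def)
    qed
    then obtain e where "e \<in> set p" "e = (u, w) \<or> e = (w, u)" using p(1) by blast
    then obtain i where i: "i < length p" "p ! i = (u, w) \<or> p ! i = (w, u)"
      by (auto simp: in_set_conv_nth)
    \<comment> \<open>The arc before \<open>(w, u)\<close> is \<open>(u, w)\<close>, and the arc before that one enters \<open>u\<close>, just as
      \<open>(w, u)\<close> does. As heads do not repeat, it is \<open>(w, u)\<close> itself, two positions back.\<close>
    obtain j where j: "j < length p" "p ! j = (w, u)"
    proof (cases "p ! i = (w, u)")
      case False
      with i have e: "p ! i = (u, w)" by simp
      let ?j = "Suc i mod length p"
      have "?j < length p" using i by (intro mod_less_divisor) auto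
      moreover have "p ! ?j = (w, u)"
        using closed_walk_successor[OF p(3) i(1)] e calculation by (intro w_arc) auto
      ultimately show thesis by (rule that)
    qed (use i that in auto)
    obtain i' where i': "i' < length p" "snd (p ! i') = w" "j = Suc i' mod length p"
      using closed_walk_predecessor[OF p(3) j(1)] j(2) by (metis fst_conv)
    then have "p ! i' = (u, w)" using w_arc' by auto
    then obtain h where h: "h < length p" "snd (p ! h) = u" "i' = Suc h mod length p"
      using closed_walk_predecessor[OF p(3) i'(1)] by (metis fst_conv)
    have "h = j"
      using nth_eq_iff_index_eq[OF p(2), of h j] h(1,2) j by simp
    moreover have "h \<noteq> j"
      using h(1,3) i'(1,3) len
      by (cases "Suc h = length p"; cases "Suc i' = length p") auto
    ultimately show False by simp
  qed
  then show ?thesis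
    using T assms pair_graph_attach_leaf connected_attach_leaf by (auto simp: is_tree_def)
qed

text \<open>
  A vertex \<open>u\<close> with a neighbour in \<open>T\<close> has degree at least two after the attachment. This is what
  keeps the ends of a growing path the only leaves, and it rules out that attaching to a
  one-vertex tree, which has no leaf, creates two leaves at once.
\<close>

lemma leaves_attach_leaf:
  assumes "pair_graph T" "u \<in> pverts T" "w \<notin> pverts T" "(u, v) \<in> parcs T"
  shows "leaves (attach_leaf T u w) \<subseteq> insert w (leaves T - {u})"
proof
  interpret T: pair_graph T by fact
  fix x assume x: "x \<in> leaves (attach_leaf T u w)"
  show "x \<in> insert w (leaves T - {u})"
  proof (cases "x = w")
    case False
    let ?N = "{y. (x, y) \<in> parcs (attach_leaf T u w)}"
    from x False have deg: "x \<in> pverts T" "card ?N = 1"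
      by (auto simp: leaves_def vdegree_conv)
    have "x \<noteq> u"
    proof
      assume "x = u"
      then have "v \<in> ?N" "w \<in> ?N" using assms(4) by auto
      moreover have "v \<noteq> w" using assms(3,4) T.in_arcsD2 by blast
      moreover obtain z where "?N = {z}" using deg(2) by (rule card_1_singletonE)
      ultimately show False by (metis singletonD)
    qed
    moreover from this have "?N = {y. (x, y) \<in> parcs T}" using False by auto
    ultimately show ?thesis using deg by (auto simp: leaves_def vdegree_conv)
  qed simp
qed

lemma (in pair_graph) connected_has_neighbour:
  assumes "connected_graph G" "u \<in> pverts G" "pverts G \<noteq> {u}"
  obtains v where "(u, v) \<in> parcs G"
  using crossing_arc[OF assms(1), of "{u}"] assms(2,3) by blast

text \<open>
  While the tree misses a vertex, connectedness provides an edge leaving it, along which a new leaf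
  can be attached. Two vertices to begin with guarantee that the old endpoint of that edge has a
  neighbour in the tree, so that each step costs at most one leaf.
\<close>

lemma (in pair_graph) extend_to_spanning_tree:
  assumes "connected_graph G" "is_tree T" "pverts T \<subseteq> pverts G" "parcs T \<subseteq> parcs G"
    "2 \<le> card (pverts T)"
  shows "\<exists>T'. spanning_ended_tree (card (leaves T) + card (pverts G - pverts T)) T' G"
  using assms(2-)
proof (induction "card (pverts G - pverts T)" arbitrary: T)
  case 0
  then have "pverts T = pverts G" using pair_finite_verts by auto
  moreover have "pair_wf_digraph T" using 0 by (auto simp: is_tree_def pair_graph_def pair_digraph_def
      pair_fin_digraph_def)
  ultimately have "spanning (with_proj T) (with_proj G)"
    using 0 pair_wf_digraph
    by (auto simp: spanning_def subgraph_def compatible_def wf_digraph_wp_iff)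
  with 0 show ?case by (auto simp: spanning_ended_tree_def ended_tree_def)
next
  case (Suc n)
  interpret T: pair_graph T using Suc.prems by (simp add: is_tree_def)
  have "pverts T \<noteq> {}" "pverts T \<noteq> pverts G" using Suc by auto
  then obtain u w where uw: "u \<in> pverts T" "w \<in> pverts G - pverts T" "(u, w) \<in> parcs G"
    using crossing_arc assms(1) Suc.prems(2) by metis
  have "pverts T \<noteq> {u}" using Suc.prems by auto
  then obtain v where v: "(u, v) \<in> parcs T"
    using T.connected_has_neighbour[of u] uw Suc.prems by (auto simp: is_tree_def)
  let ?A = "attach_leaf T u w"
  have fin: "finite (leaves T)" using T.pair_finite_verts by (auto simp: leaves_def)
  have "card (leaves ?A) \<le> card (insert w (leaves T - {u}))"
    using fin uw v by (intro card_mono leaves_attach_leaf T.pair_graph) auto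
  also have "\<dots> \<le> card (leaves T) + 1"
    using fin by (metis card_Diff1_le card_insert_le_m1 One_nat_def add.commute card_insert_disjoint
        finite_Diff insert_absorb le_Suc_eq le_diff_conv plus_1_eq_Suc Suc_le_mono)
  finally have lv: "card (leaves ?A) \<le> card (leaves T) + 1" .
  have n: "n = card (pverts G - pverts ?A)"
  proof -
    have "pverts G - pverts ?A = (pverts G - pverts T) - {w}" by auto
    then show ?thesis using uw Suc.hyps(2) pair_finite_verts by simp
  qed
  have "\<exists>T'. spanning_ended_tree (card (leaves ?A) + card (pverts G - pverts ?A)) T' G"
  proof (rule Suc.hyps(1)[OF n])
    show "is_tree ?A" using is_tree_attach_leaf Suc.prems uw by auto
    show "parcs ?A \<subseteq> parcs G" using Suc.prems uw arcs_symmetric by auto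
    show "2 \<le> card (pverts ?A)" using Suc.prems uw T.pair_finite_verts by simp
  qed (use Suc.prems uw in auto)
  moreover have "card (leaves ?A) + card (pverts G - pverts ?A) \<le>
      card (leaves T) + card (pverts G - pverts T)"
    using lv n Suc.hyps(2) by linarith
  ultimately show ?case
    by (meson spanning_ended_tree_def ended_tree_def le_trans)
qed

section \<open>Longest paths\<close>

definition simple_path :: "'a pair_pre_digraph \<Rightarrow> 'a list \<Rightarrow> bool" where
  "simple_path G p \<longleftrightarrow> p \<noteq> [] \<and> distinct p \<and> set p \<subseteq> pverts G \<and> successively (\<lambda>u v. (u, v) \<in> parcs G) p"

lemma (in pair_graph) simple_path_Cons:
  assumes "simple_path G p" "w \<in> pverts G - set p" "(w, hd p) \<in> parcs G"
  shows "simple_path G (w # p)"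
  using assms by (auto simp: simple_path_def successively_Cons)

lemma (in pair_graph) simple_path_rev: "simple_path G (rev p) \<longleftrightarrow> simple_path G p"
proof -
  have "successively (\<lambda>x y. (y, x) \<in> parcs G) p = successively (\<lambda>x y. (x, y) \<in> parcs G) p"
    by (rule successively_cong) (auto intro: arcs_symmetric)
  then show ?thesis by (simp add: simple_path_def successively_rev)
qed

lemma (in pair_graph) tree_of_simple_path:
  assumes "simple_path G p"
  shows "\<exists>T. is_tree T \<and> pverts T = set p \<and> parcs T \<subseteq> parcs G \<and> leaves T \<subseteq> {hd p, last p}"
  using assms
proof (induction p)
  case Nil
  then show ?case by (simp add: simple_path_def)
next
  case (Cons w p)
  show ?case
  proof (cases p)
    case Nil
    let ?T = "\<lparr>pverts = {w}, parcs = {}\<rparr>"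
    interpret T: pair_graph ?T by (rule pair_graphI) (auto simp: sym_def irrefl_def)
    have "is_tree ?T"
      using T.pair_graph by (auto simp: is_tree_def T.connected_graph_iff cycle_iff)
    moreover have "leaves ?T \<subseteq> {w}" by (auto simp: leaves_def)
    ultimately show ?thesis using Nil by (intro exI[of _ ?T]) auto
  next
    case p: (Cons u q)
    with Cons.prems have "simple_path G p" and w: "w \<notin> set p" "(w, u) \<in> parcs G"
      by (auto simp: simple_path_def)
    then obtain T where T: "is_tree T" "pverts T = set p" "parcs T \<subseteq> parcs G"
      "leaves T \<subseteq> {u, last p}" using Cons.IH p by auto
    interpret T: pair_graph T using T by (simp add: is_tree_def)
    have "leaves (attach_leaf T u w) \<subseteq> {w, last p}"
    proof (cases q)
      case Nil
      then show ?thesis using T p by (auto simp: leaves_def)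
    next
      case (Cons v r)
      with p \<open>simple_path G p\<close> have "v \<noteq> u" "v \<in> set p" by (auto simp: simple_path_def)
      then obtain v' where "(u, v') \<in> parcs T"
        using T.connected_has_neighbour[of u] T p by (auto simp: is_tree_def)
      then have "leaves (attach_leaf T u w) \<subseteq> insert w (leaves T - {u})"
        using T p w by (intro leaves_attach_leaf T.pair_graph) auto
      with T show ?thesis by auto
    qed
    moreover have "is_tree (attach_leaf T u w)"
      using T p w by (intro is_tree_attach_leaf) auto
    ultimately show ?thesis
      using T p w arcs_symmetric by (intro exI[of _ "attach_leaf T u w"]) auto
  qed
qed

lemma (in pair_graph) longest_path_exists:
  assumes "pverts G \<noteq> {}"
  obtains p where "simple_path G p" "\<And>q. simple_path G q \<Longrightarrow> length q \<le> length p"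
proof -
  obtain v where "v \<in> pverts G" using assms by auto
  then have "simple_path G [v]" by (simp add: simple_path_def)
  moreover have "\<forall>q. simple_path G q \<longrightarrow> length q \<le> card (pverts G)"
  proof (intro allI impI)
    fix q assume "simple_path G q"
    then show "length q \<le> card (pverts G)"
      using card_mono[OF pair_finite_verts, of "set q"] by (simp add: simple_path_def distinct_card)
  qed
  ultimately show thesis
    using ex_has_greatest_nat[of "simple_path G" "[v]" length "Suc (card (pverts G))"] that
    by (metis less_Suc_eq_le)
qed

text \<open>
  If the ends of a path \<open>c\<close> are adjacent, the path can be rotated to start at any of its vertices,
  in particular at one that has a neighbour \<open>w\<close> outside, and \<open>w\<close> is then put in front.
\<close>

lemma (in pair_graph) cycle_gives_longer_path:
  assumes "connected_graph G" "simple_path G c" "set c \<noteq> pverts G" "(last c, hd c) \<in> parcs G"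
  shows "\<exists>q. simple_path G q \<and> length q = Suc (length c)"
proof -
  have "set c \<noteq> {}" "set c \<subseteq> pverts G" using assms by (auto simp: simple_path_def)
  then obtain u w where uw: "u \<in> set c" "w \<in> pverts G - set c" "(u, w) \<in> parcs G"
    using crossing_arc assms by metis
  then obtain a b where c: "c = a @ u # b" by (meson split_list)
  have "simple_path G ((u # b) @ a)"
    using assms(2,4) unfolding c simple_path_def successively_append_iff
    by (cases a) auto
  then have "simple_path G (w # (u # b) @ a)"
    using uw c arcs_symmetric by (intro simple_path_Cons) auto
  then show ?thesis using c by (intro exI[of _ "w # (u # b) @ a"]) auto
qed

text \<open>
  Ore's crossing argument. For a longest path \<open>p\<close> with \<open>m\<close> vertices, the neighbours of both ends
  lie on \<open>p\<close>. If \<open>hd p\<close> is adjacent to \<open>p ! Suc i\<close> and \<open>last p\<close> to \<open>p ! i\<close>, then reversing the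
  initial segment up to \<open>p ! i\<close> gives a path on the same vertices with adjacent ends, which cannot
  be. So each of the \<open>m - 1\<close> indices \<open>i\<close> accounts for at most one edge at the two ends.
\<close>

lemma (in pair_graph) longest_path_ends:
  assumes conn: "connected_graph G" and p: "simple_path G p"
    and longest: "\<And>q. simple_path G q \<Longrightarrow> length q \<le> length p" and ns: "set p \<noteq> pverts G"
  shows "hd p \<noteq> last p" "(hd p, last p) \<notin> parcs G"
    "vdegree G (hd p) + vdegree G (last p) < length p"
proof -
  let ?m = "length p"
  have pne: "p \<noteq> []" and dist: "distinct p" using p by (auto simp: simple_path_def)
  have closable: "(last c, hd c) \<notin> parcs G" if "simple_path G c" "set c = set p" for c
  proof -
    have "length c = length p" using that dist by (metis simple_path_def distinct_card)
    with cycle_gives_longer_path[OF conn that(1)] that(2) ns longest show ?thesis by force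
  qed
  from closable[OF p] show nadj: "(hd p, last p) \<notin> parcs G" using arcs_symmetric by blast
  have N1: "v \<in> set p" if "(hd p, v) \<in> parcs G" for v
    using longest[OF simple_path_Cons[OF p, of v]] that arcs_symmetric in_arcsD2 by fastforce
  have Nm: "v \<in> set p" if "(last p, v) \<in> parcs G" for v
  proof (rule ccontr)
    assume "v \<notin> set p"
    then have "simple_path G (v # rev p)"
      using p that arcs_symmetric in_arcsD2 by (intro simple_path_Cons) (auto simp: simple_path_rev hd_rev)
    with longest show False by fastforce
  qed
  show "hd p \<noteq> last p"
  proof
    assume eq: "hd p = last p"
    then have "set p = {hd p}" using pne dist by (cases p) (auto split: if_splits)
    then show False
      using crossing_arc[OF conn, of "{hd p}"] p ns N1 by (auto simp: simple_path_def)
  qed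
  let ?A = "{i. Suc i < ?m \<and> (hd p, p ! Suc i) \<in> parcs G}"
  let ?B = "{i. Suc i < ?m \<and> (last p, p ! i) \<in> parcs G}"
  have "{v. (hd p, v) \<in> parcs G} = (\<lambda>i. p ! Suc i) ` ?A"
  proof (intro set_eqI iffI)
    fix v assume v: "v \<in> {v. (hd p, v) \<in> parcs G}"
    then obtain j where j: "j < ?m" "v = p ! j" using N1 by (metis in_set_conv_nth mem_Collect_eq)
    with v pne no_loops'[of "hd p" v] have "j \<noteq> 0" by (metis hd_conv_nth mem_Collect_eq)
    with j v show "v \<in> (\<lambda>i. p ! Suc i) ` ?A" by (intro image_eqI[of _ _ "j - 1"]) auto
  qed auto
  moreover have "inj_on (\<lambda>i. p ! Suc i) ?A" using dist by (auto simp: inj_on_def nth_eq_iff_index_eq)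
  ultimately have d1: "vdegree G (hd p) = card ?A" by (simp add: vdegree_conv card_image)
  have "{v. (last p, v) \<in> parcs G} = (\<lambda>i. p ! i) ` ?B"
  proof (intro set_eqI iffI)
    fix v assume v: "v \<in> {v. (last p, v) \<in> parcs G}"
    then obtain j where j: "j < ?m" "v = p ! j" using Nm by (metis in_set_conv_nth mem_Collect_eq)
    with v pne no_loops'[of "last p" v] have "j \<noteq> ?m - 1" by (metis last_conv_nth mem_Collect_eq)
    with j v show "v \<in> (\<lambda>i. p ! i) ` ?B" by (intro image_eqI[of _ _ j]) auto
  qed auto
  moreover have "inj_on (\<lambda>i. p ! i) ?B" using dist by (auto simp: inj_on_def nth_eq_iff_index_eq)
  ultimately have dm: "vdegree G (last p) = card ?B" by (simp add: vdegree_conv card_image)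
  have disj: "?A \<inter> ?B = {}"
  proof (rule ccontr)
    assume "?A \<inter> ?B \<noteq> {}"
    then obtain i where i: "Suc i < ?m" "(hd p, p ! Suc i) \<in> parcs G" "(last p, p ! i) \<in> parcs G"
      by auto
    let ?a = "take (Suc i) p" and ?b = "drop (Suc i) p"
    have ab: "?a @ ?b = p" "?a \<noteq> []" "?b \<noteq> []" using i pne by auto
    have "last ?a = p ! i" using i by (simp add: take_Suc_conv_app_nth)
    then have ends: "hd ?a = hd p" "last ?a = p ! i" "hd ?b = p ! Suc i" "last ?b = last p"
      using i pne by (auto simp: hd_drop_conv_nth)
    have va: "simple_path G ?a" and vb: "simple_path G ?b" and dj: "set ?a \<inter> set ?b = {}"
      using p ab unfolding simple_path_def
      by (metis ab(1) distinct_append successively_append_iff set_append Un_subset_iff)+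
    have "simple_path G (rev ?a)" using va by (simp add: simple_path_rev)
    with vb dj ab ends i(2) have "simple_path G (rev ?a @ ?b)"
      unfolding simple_path_def by (simp add: successively_append_iff last_rev)
    moreover have "set (rev ?a @ ?b) = set p" using ab(1) by (metis set_append set_rev)
    moreover have "(last (rev ?a @ ?b), hd (rev ?a @ ?b)) \<in> parcs G"
      using i ab ends by (simp add: hd_rev)
    ultimately show False using closable by blast
  qed
  have fin: "finite ?A" "finite ?B" by (auto intro: finite_subset[of _ "{..<?m}"])
  have "card ?A + card ?B = card (?A \<union> ?B)" using fin disj by (simp add: card_Un_disjoint)
  also have "\<dots> \<le> card {..<?m - 1}" by (intro card_mono) auto
  also have "\<dots> < ?m" using pne by simp
  finally show "vdegree G (hd p) + vdegree G (last p) < ?m" using d1 dm by simp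
qed

text \<open>
  The theorem of Broersma and Tuinstra; the condition is \<open>d(x) + d(y) \<ge> n - k + 1\<close> without
  subtraction.
\<close>

lemma (in pair_graph) ore_spanning_ended_tree:
  assumes "k \<ge> 2" "connected_graph G"
    and ore: "\<And>x y. x \<in> pverts G \<Longrightarrow> y \<in> pverts G \<Longrightarrow> x \<noteq> y \<Longrightarrow> (x, y) \<notin> parcs G \<Longrightarrow>
      card (pverts G) < vdegree G x + vdegree G y + k"
  shows "\<exists>T. spanning_ended_tree k T G"
proof -
  have "pverts G \<noteq> {}" using assms(2) connected_graph_iff by blast
  then obtain p where p: "simple_path G p" "\<And>q. simple_path G q \<Longrightarrow> length q \<le> length p"
    using longest_path_exists by metis
  have sub: "set p \<subseteq> pverts G" and len: "card (set p) = length p" and pne: "p \<noteq> []"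
    using p(1) by (auto simp: simple_path_def distinct_card)
  obtain T where T: "is_tree T" "pverts T = set p" "parcs T \<subseteq> parcs G" "leaves T \<subseteq> {hd p, last p}"
    using tree_of_simple_path[OF p(1)] by auto
  have "card (leaves T) \<le> card {hd p, last p}" using T by (intro card_mono) auto
  also have "\<dots> \<le> 2" by (auto simp: card_insert_if)
  finally have lv: "card (leaves T) \<le> 2" .
  show ?thesis
  proof (cases "set p = pverts G")
    case True
    interpret T: pair_graph T using T by (simp add: is_tree_def)
    have "spanning (with_proj T) (with_proj G)"
      using T True pair_wf_digraph T.pair_wf_digraph
      by (auto simp: spanning_def subgraph_def compatible_def wf_digraph_wp_iff)
    with T lv assms(1) show ?thesis by (auto simp: spanning_ended_tree_def ended_tree_def)
  next
    case False
    note e = longest_path_ends[OF assms(2) p False]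
    have "hd p \<in> pverts G" "last p \<in> pverts G" using sub pne by auto
    from ore[OF this e(1,2)] e(3) have n: "card (pverts G) + 2 \<le> length p + k" by linarith
    have "card (pverts G - set p) = card (pverts G) - length p"
      using sub len by (simp add: card_Diff_subset)
    moreover have "length p \<le> card (pverts G)"
      using card_mono[OF pair_finite_verts sub] len by simp
    ultimately have b: "card (leaves T) + card (pverts G - pverts T) \<le> k"
      using n lv assms(1) T(2) by simp
    have "{hd p, last p} \<subseteq> set p" using pne by auto
    then have "2 \<le> card (pverts T)" using e(1) T card_mono[of "set p" "{hd p, last p}"] by simp
    with extend_to_spanning_tree[OF assms(2) T(1) _ T(3)] T(2) sub b show ?thesis
      by (metis spanning_ended_tree_def ended_tree_def le_trans)
  qed
qed

section \<open>Induced subgraphs on four vertices\<close>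

definition induced :: "'a pair_pre_digraph \<Rightarrow> 'a set \<Rightarrow> 'a pair_pre_digraph" where
  "induced G S = \<lparr>pverts = S, parcs = parcs G \<inter> S \<times> S\<rparr>"

definition among_five_graphs :: "'a pair_pre_digraph \<Rightarrow> bool" where
  "among_five_graphs H \<longleftrightarrow>
    graph_iso H (disjoint_union (complete_bipartite_graph 1 2) (complete_graph 1)) \<or>
    graph_iso H (disjoint_union (complete_graph 3) (complete_graph 1)) \<or>
    graph_iso H (complete_bipartite_graph 1 3) \<or>
    graph_iso H claw_plus_edge \<or>
    graph_iso H (path_graph 4)"

lemma (in pair_graph) induced_in_induced: "S \<subseteq> pverts G \<Longrightarrow> induced_in (induced G S) G"
  using induced_in_conv[OF pair_wf_digraph] by (auto simp: induced_def)

lemma bij_betw_four: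
  assumes "distinct [a, b, c, d]" "distinct [a', b', c', d']"
  shows "bij_betw (\<lambda>z. if z = a then a' else if z = b then b' else if z = c then c' else d')
    {a, b, c, d} {a', b', c', d'}"
  using assms by (auto simp: bij_betw_def inj_on_def)

text \<open>
  Isomorphism of graphs on four vertices reduces to comparing the six pairs of corresponding
  vertices.
\<close>

lemma (in pair_graph) iso_inducedI:
  assumes "distinct [a, b, c, d]" "distinct [a', b', c', d']"
    and "pverts H = {a', b', c', d'}" "parcs H \<subseteq> pverts H \<times> pverts H" "sym (parcs H)" "irrefl (parcs H)"
    and "(a, b) \<in> parcs G \<longleftrightarrow> (a', b') \<in> parcs H" "(a, c) \<in> parcs G \<longleftrightarrow> (a', c') \<in> parcs H"
    "(a, d) \<in> parcs G \<longleftrightarrow> (a', d') \<in> parcs H" "(b, c) \<in> parcs G \<longleftrightarrow> (b', c') \<in> parcs H"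
    "(b, d) \<in> parcs G \<longleftrightarrow> (b', d') \<in> parcs H" "(c, d) \<in> parcs G \<longleftrightarrow> (c', d') \<in> parcs H"
  shows "graph_iso (induced G {a, b, c, d}) H"
proof -
  let ?f = "\<lambda>z. if z = a then a' else if z = b then b' else if z = c then c' else d'"
  have sG: "\<And>x y. (x, y) \<in> parcs G \<longleftrightarrow> (y, x) \<in> parcs G" using arcs_symmetric by blast
  have sH: "\<And>x y. (x, y) \<in> parcs H \<longleftrightarrow> (y, x) \<in> parcs H" using assms(5) by (auto simp: sym_def)
  have lG: "\<And>x. (x, x) \<notin> parcs G" using no_loops' by blast
  have lH: "\<And>x. (x, x) \<notin> parcs H" using assms(6) by (auto simp: irrefl_def)
  have ne: "a \<noteq> b" "a \<noteq> c" "a \<noteq> d" "b \<noteq> c" "b \<noteq> d" "c \<noteq> d" using assms(1) by auto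
  have 1: "pair_wf_digraph (induced G {a, b, c, d})" by unfold_locales (auto simp: induced_def)
  have 2: "pair_wf_digraph H" by unfold_locales (use assms(4) in auto)
  have "(u, v) \<in> parcs G \<longleftrightarrow> (?f u, ?f v) \<in> parcs H"
    if "u \<in> {a, b, c, d}" "v \<in> {a, b, c, d}" for u v
    using that
    by (elim insertE emptyE)
      (simp_all add: ne ne[symmetric] lG lH sG[of b a] sG[of c a] sG[of d a] sG[of c b] sG[of d b]
        sG[of d c] sH[of b' a'] sH[of c' a'] sH[of d' a'] sH[of c' b'] sH[of d' b'] sH[of d' c']
        assms(7-))
  then show ?thesis
    using bij_betw_four[OF assms(1,2)] assms(3)
    by (subst graph_iso_conv[OF 1 2], intro exI[of _ ?f]) (auto simp: induced_def)
qed

context pair_graph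
begin

lemma induced_P3_K1:
  assumes "distinct [a, b, c, d]" "(a, b) \<in> parcs G" "(b, c) \<in> parcs G"
    "(a, c) \<notin> parcs G" "(a, d) \<notin> parcs G" "(b, d) \<notin> parcs G" "(c, d) \<notin> parcs G"
  shows "among_five_graphs (induced G {a, b, c, d})"
proof -
  have "graph_iso (induced G {a, b, c, d}) 
      (disjoint_union (complete_bipartite_graph 1 2) (complete_graph 1))"
    by (rule iso_inducedI[where a' = "Inl (Inr 0)" and b' = "Inl (Inl 0)" and c' = "Inl (Inr 1)"
          and d' = "Inr 0"])
      (use assms in \<open>auto simp: disjoint_union_def complete_bipartite_graph_def complete_graph_def
        sym_def irrefl_def numeral_2_eq_2 lessThan_Suc\<close>)
  then show ?thesis by (simp add: among_five_graphs_def)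
qed

lemma induced_K3_K1:
  assumes "distinct [a, b, c, d]" "(a, b) \<in> parcs G" "(b, c) \<in> parcs G"
    "(a, c) \<in> parcs G" "(a, d) \<notin> parcs G" "(b, d) \<notin> parcs G" "(c, d) \<notin> parcs G"
  shows "among_five_graphs (induced G {a, b, c, d})"
proof -
  have "graph_iso (induced G {a, b, c, d}) (disjoint_union (complete_graph 3) (complete_graph 1))"
    by (rule iso_inducedI[where a' = "Inl 0" and b' = "Inl 1" and c' = "Inl 2" and d' = "Inr 0"])
      (use assms in \<open>auto simp: disjoint_union_def complete_graph_def
        sym_def irrefl_def numeral_2_eq_2 numeral_3_eq_3 lessThan_Suc map_prod_def image_iff\<close>)
  then show ?thesis by (simp add: among_five_graphs_def)
qed

lemma induced_claw:
  assumes "distinct [a, b, c, d]" "(a, b) \<in> parcs G" "(a, c) \<in> parcs G" "(a, d) \<in> parcs G"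
    "(b, c) \<notin> parcs G" "(b, d) \<notin> parcs G" "(c, d) \<notin> parcs G"
  shows "among_five_graphs (induced G {a, b, c, d})"
proof -
  have "graph_iso (induced G {a, b, c, d}) (complete_bipartite_graph 1 3)"
    by (rule iso_inducedI[where a' = "Inl 0" and b' = "Inr 0" and c' = "Inr 1" and d' = "Inr 2"])
      (use assms in \<open>auto simp: complete_bipartite_graph_def
        sym_def irrefl_def numeral_2_eq_2 numeral_3_eq_3 lessThan_Suc\<close>)
  then show ?thesis by (simp add: among_five_graphs_def)
qed

lemma induced_paw:
  assumes "distinct [a, b, c, d]" "(a, b) \<in> parcs G" "(a, c) \<in> parcs G" "(a, d) \<in> parcs G"
    "(b, c) \<in> parcs G" "(b, d) \<notin> parcs G" "(c, d) \<notin> parcs G"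
  shows "among_five_graphs (induced G {a, b, c, d})"
proof -
  have "graph_iso (induced G {a, b, c, d}) claw_plus_edge"
    by (rule iso_inducedI[where a' = "Inl 0" and b' = "Inr 0" and c' = "Inr 1" and d' = "Inr 2"])
      (use assms in \<open>auto simp: claw_plus_edge_def add_edge_def complete_bipartite_graph_def
        sym_def irrefl_def numeral_2_eq_2 numeral_3_eq_3 lessThan_Suc\<close>)
  then show ?thesis by (simp add: among_five_graphs_def)
qed

lemma induced_P4:
  assumes "distinct [a, b, c, d]" "(a, b) \<in> parcs G" "(b, c) \<in> parcs G" "(c, d) \<in> parcs G"
    "(a, c) \<notin> parcs G" "(a, d) \<notin> parcs G" "(b, d) \<notin> parcs G"
  shows "among_five_graphs (induced G {a, b, c, d})"
proof -
  have "graph_iso (induced G {a, b, c, d}) (path_graph 4)"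
    by (rule iso_inducedI[where a' = 0 and b' = 1 and c' = 2 and d' = 3])
      (use assms in \<open>auto simp: path_graph_def sym_def irrefl_def\<close>)
  then show ?thesis by (simp add: among_five_graphs_def)
qed

text \<open>
  If \<open>v\<close> is not adjacent to \<open>x\<close>, then \<open>x, y, u, v\<close> induce the path \<open>x u y\<close> together with a
  vertex \<open>v\<close> that may be joined to \<open>y\<close> and to \<open>u\<close>; all four possibilities are listed.
\<close>

lemma common_neighbour_dominates:
  assumes xy: "x \<noteq> y" "(x, y) \<notin> parcs G"
    and unlisted: "\<And>S. S \<subseteq> pverts G \<Longrightarrow> {x, y} \<subseteq> S \<Longrightarrow> \<not> among_five_graphs (induced G S)"
    and u: "(x, u) \<in> parcs G" "(y, u) \<in> parcs G"
    and v: "v \<in> pverts G - {x, y}"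
  shows "(x, v) \<in> parcs G"
proof (rule ccontr)
  assume xv: "(x, v) \<notin> parcs G"
  have S: "\<not> among_five_graphs (induced G {x, y, u, v})"
    using u v in_arcsD1 in_arcsD2 by (intro unlisted) auto
  have d: "distinct [x, y, u, v]" using assms xv no_loops' by auto
  have s: "\<And>a b. (a, b) \<in> parcs G \<longleftrightarrow> (b, a) \<in> parcs G" using arcs_symmetric by blast
  have perms: "{x, u, y, v} = {x, y, u, v}" "{u, x, y, v} = {x, y, u, v}"
    "{u, y, v, x} = {x, y, u, v}" by auto
  show False
  proof (cases "(y, v) \<in> parcs G"; cases "(u, v) \<in> parcs G")
    assume "(y, v) \<in> parcs G" "(u, v) \<in> parcs G"
    then show False using induced_paw[of u y v x] S d u xy xv s perms by auto
  next
    assume "(y, v) \<in> parcs G" "(u, v) \<notin> parcs G"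
    then show False using induced_P4[of x u y v] S d u xy xv s perms by auto
  next
    assume "(y, v) \<notin> parcs G" "(u, v) \<in> parcs G"
    then show False using induced_claw[of u x y v] S d u xy xv s perms by auto
  next
    assume "(y, v) \<notin> parcs G" "(u, v) \<notin> parcs G"
    then show False using induced_P3_K1[of x u y v] S d u xy xv s perms by auto
  qed
qed

text \<open>
  Without common neighbours of \<open>x\<close> and \<open>y\<close>, an edge \<open>x u\<close> is a whole component: a further
  neighbour \<open>v\<close> of \<open>x\<close> or \<open>u\<close> would turn \<open>x, u, v\<close> into a path or a triangle, to which \<open>y\<close> is
  either not joined at all or, in the case of the path \<open>x u v\<close>, possibly joined at \<open>v\<close>, and these
  graphs are all listed.
\<close>

lemma private_neighbour_isolates:
  assumes xy: "y \<in> pverts G" "x \<noteq> y" "(x, y) \<notin> parcs G"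
    and unlisted: "\<And>S. S \<subseteq> pverts G \<Longrightarrow> {x, y} \<subseteq> S \<Longrightarrow> \<not> among_five_graphs (induced G S)"
    and no_common: "\<And>u. (x, u) \<in> parcs G \<Longrightarrow> (y, u) \<notin> parcs G"
    and u: "(x, u) \<in> parcs G" and v: "v \<notin> {x, u}"
  shows "(x, v) \<notin> parcs G" "(u, v) \<notin> parcs G"
proof -
  have s: "\<And>a b. (a, b) \<in> parcs G \<longleftrightarrow> (b, a) \<in> parcs G" using arcs_symmetric by blast
  have "(x, v) \<notin> parcs G \<and> (u, v) \<notin> parcs G"
  proof (rule ccontr)
    assume c: "\<not> ?thesis"
    have yu: "(y, u) \<notin> parcs G" using u no_common by blast
    then have d: "distinct [x, y, u, v]" using c xy u v no_loops' s by auto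
    have S: "\<not> among_five_graphs (induced G {x, y, u, v})"
      using c u xy in_arcsD1 in_arcsD2 by (intro unlisted) auto
    have perms: "{v, x, u, y} = {x, y, u, v}" "{x, u, v, y} = {x, y, u, v}" by auto
    show False
    proof (cases "(x, v) \<in> parcs G")
      case True
      then show False
        using induced_K3_K1[of x u v y] induced_P3_K1[of v x u y] S d u xy yu s perms no_common[of v]
        by (cases "(u, v) \<in> parcs G") auto
    next
      case False
      then show False
        using c induced_P4[of x u v y] induced_P3_K1[of x u v y] S d u xy yu s perms
        by (cases "(v, y) \<in> parcs G") auto
    qed
  qed
  then show "(x, v) \<notin> parcs G" "(u, v) \<notin> parcs G" by auto
qed

text \<open>
  Since \<open>{x, u}\<close> cannot be a component, \<open>x\<close> and \<open>y\<close> have a common neighbour and are therefore both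
  adjacent to everything else. The sum \<open>2 (n - 2)\<close> of their degrees is at least \<open>n - 1\<close> because
  \<open>n \<ge> 3\<close>, and hence satisfies the degree condition for every \<open>k \<ge> 2\<close>.
\<close>

lemma unlisted_pair_degrees:
  assumes conn: "connected_graph G"
    and xy: "x \<in> pverts G" "y \<in> pverts G" "x \<noteq> y" "(x, y) \<notin> parcs G"
    and unlisted: "\<And>S. S \<subseteq> pverts G \<Longrightarrow> {x, y} \<subseteq> S \<Longrightarrow> \<not> among_five_graphs (induced G S)"
  shows "3 \<le> card (pverts G)" "vdegree G x = card (pverts G) - 2"
    "vdegree G y = card (pverts G) - 2"
proof -
  have yx: "(y, x) \<notin> parcs G" using xy arcs_symmetric by blast
  have "\<exists>u. (x, u) \<in> parcs G \<and> (y, u) \<in> parcs G"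
  proof (rule ccontr)
    assume "\<not> ?thesis"
    then have no_common: "\<And>u. (x, u) \<in> parcs G \<Longrightarrow> (y, u) \<notin> parcs G" by blast
    obtain u where u: "(x, u) \<in> parcs G"
      using connected_has_neighbour[OF conn xy(1)] xy by (metis singletonD)
    have "y \<notin> {x, u}" using u xy by auto
    then have "{x, u} \<noteq> pverts G" using xy by auto
    then obtain a b where "a \<in> {x, u}" "b \<in> pverts G - {x, u}" "(a, b) \<in> parcs G"
      using crossing_arc[OF conn, of "{x, u}"] u xy in_arcsD2 by auto
    then show False
      using private_neighbour_isolates[OF xy(2-4) unlisted no_common u, of b] by auto
  qed
  then obtain u where u: "(x, u) \<in> parcs G" "(y, u) \<in> parcs G" by auto
  have "{v. (x, v) \<in> parcs G} = pverts G - {x, y}"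
    using common_neighbour_dominates[OF xy(3,4) unlisted u] xy no_loops' in_arcsD2 by blast
  moreover have "{v. (y, v) \<in> parcs G} = pverts G - {x, y}"
    using common_neighbour_dominates[OF xy(3)[symmetric] yx _ u(2,1)] unlisted xy yx no_loops' in_arcsD2
    by (auto simp: insert_commute)
  moreover have "card (pverts G - {x, y}) = card (pverts G) - 2"
    using xy pair_finite_verts by (simp add: card_Diff_subset)
  ultimately show "vdegree G x = card (pverts G) - 2" "vdegree G y = card (pverts G) - 2"
    by (simp_all add: vdegree_conv)
  have "{x, y, u} \<subseteq> pverts G" "card {x, y, u} = 3" using xy u yx no_loops' in_arcsD2 by auto
  then show "3 \<le> card (pverts G)" using pair_finite_verts by (metis card_mono)
qed

end

section \<open>Spanning trees with few leaves\<close>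

theorem theorem2:
  fixes G :: "'a pair_pre_digraph" and k :: nat
  assumes "k \<ge> 2"
    and "pair_graph G"
    and "connected_graph G"
    and "\<And>H x y.
          induced_in H G \<Longrightarrow>
          graph_iso H (disjoint_union (complete_bipartite_graph 1 2) (complete_graph 1)) \<or>
          graph_iso H (disjoint_union (complete_graph 3) (complete_graph 1)) \<or>
          graph_iso H (complete_bipartite_graph 1 3) \<or>
          graph_iso H claw_plus_edge \<or>
          graph_iso H (path_graph 4) \<Longrightarrow>
          x \<in> pverts H \<Longrightarrow> y \<in> pverts H \<Longrightarrow> x \<noteq> y \<Longrightarrow> (x, y) \<notin> parcs H \<Longrightarrow>
          int (vdegree G x) + int (vdegree G y) \<ge> int (card (pverts G)) - int k + 1"
  shows "\<exists>T. spanning_ended_tree k T G"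
proof -
  interpret pair_graph G by fact
  show ?thesis
  proof (rule ore_spanning_ended_tree[OF assms(1,3)])
    fix x y assume xy: "x \<in> pverts G" "y \<in> pverts G" "x \<noteq> y" "(x, y) \<notin> parcs G"
    show "card (pverts G) < vdegree G x + vdegree G y + k"
    proof (cases "\<exists>S \<subseteq> pverts G. {x, y} \<subseteq> S \<and> among_five_graphs (induced G S)")
      case True
      then obtain S where S: "S \<subseteq> pverts G" "x \<in> S" "y \<in> S" "among_five_graphs (induced G S)" by auto
      have "int (vdegree G x) + int (vdegree G y) \<ge> int (card (pverts G)) - int k + 1"
        by (rule assms(4)[of "induced G S"])
          (use S xy induced_in_induced in \<open>auto simp: among_five_graphs_def induced_def\<close>)
      then show ?thesis by linarith
    next
      case False
      then have "\<And>S. S \<subseteq> pverts G \<Longrightarrow> {x, y} \<subseteq> S \<Longrightarrow> \<not> among_five_graphs (induced G S)" by blast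
      from unlisted_pair_degrees[OF assms(3) xy this] assms(1) show ?thesis by linarith
    qed
  qed
qed

end
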